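(* Let $(X,M,* )$ be a uniformly locally finite fuzzy metric space (with $*$ having no zero divisors) that has property A. Then there exists a coarse embedding of $(X,M,* )$ into a (separable) Hilbert space, where the Hilbert space is regarded as the standard fuzzy metric space induced by its norm metric.
   Context: A continuous $t$-norm is a continuous, associative, commutative binary operation $*$ on $[0,1]$ with $a*1=a$ for all $a$, and $a*b\leq c*d$ whenever $a\leq c$ and $b\leq d$. Standing assumption: $*$ has no zero divisors, i.e. $a*b\neq 0$ whenever $a\neq 0$ and $b\neq 0$. A fuzzy metric space (George–Veeramani) is a triple $(X,M,* )$ with $X$ a set, $*$ a continuous $t$-norm, and $M:X\times X\times(0,\infty)\to[0,1]$ such that for all $x,y,z\in X$ and $s,t>0$: (1) $M(x,y,t)>0$; (2) $M(x,y,t)=1$ if and only if $x=y$; (3) $M(x,y,t)=M(y,x,t)$; (4) $M(x,y,t)*M(y,z,s)\leq M(x,z,t+s)$; (5) $M(x,y,\cdot)$ is continuous on $(0,\infty)$. If $(Y,d)$ is a metric space, the standard fuzzy metric space induced by $d$ is $(Y,M_d,\cdot)$ where $\cdot$ is the product $t$-norm $a\cdot b=ab$ and $M_d(x,y,t)=\frac{t}{t+d(x,y)}$. For $x\in X$, $r\in(0,1)$, $t>0$, the ball is $B(x,r,t)=\{y\in X:M(x,y,t)>1-r\}$. The space is uniformly locally finite if for every $r\in(0,1)$ and $t>0$ there is $N_{r,t}>0$ with $|B(x,r,t)|<N_{r,t}$ for all $x\in X$. A uniformly locally finite fuzzy metric space $(X,M,* )$ has property A if for every $\varepsilon>0$,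 $t>0$, $r\in(0,1)$ there exist $t'>0$, $r'\in(0,1)$ and a family $\{A_x\}_{x\in X}$ of non-empty finite subsets of $X\times\mathbb{N}$ such that $A_x\subset B(x,r',t')\times\mathbb{N}$ for each $x$, and $|A_x\Delta A_y|<\varepsilon|A_x\cap A_y|$ whenever $M(x,y,t)>1-r$. Here $\Delta$ is symmetric difference. A map $f:X\to Y$ between fuzzy metric spaces $(X,M_1,*_1)$, $(Y,M_2,*_2)$ is: uniformly expansive if for all $A>0$ and $t>0$ there exist $B\in(0,1)$ and $t'>0$ such that $M_2(f(x),f(x'),t')\geq B$ whenever $M_1(x,x',t)\geq A$; effectively proper if for all $C>0$ and $t>0$ there exist $D\in(0,1)$ and $t'>0$ such that $M_1(x,x',t')\geq D$ whenever $M_2(f(x),f(x'),t)\geq C$; a coarse embedding if it is both uniformly expansive and effectively proper. *)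

theory Defs
  imports "HOL-Analysis.Analysis"
begin

section \<open>The separable Hilbert space of square-summable real sequences\<close>

text \<open>The instances below make \<open>ell2\<close> a separable real Hilbert space: \<^class>\<open>real_inner\<close> together with
  \<^class>\<open>polish_space\<close> (complete and second countable, i.e. separable). Every separable Hilbert
  space embeds isometrically into it.\<close>

typedef ell2 = "{f :: nat \<Rightarrow> real. summable (\<lambda>n. (f n)\<^sup>2)}"
  morphisms ell2_nth Abs_ell2
  by (rule exI[of _ "\<lambda>_. 0"]) simp

setup_lifting type_definition_ell2

lemma summable_ell2_mult:
  fixes f g :: "nat \<Rightarrow> real"
  assumes "summable (\<lambda>n. (f n)\<^sup>2)" and "summable (\<lambda>n. (g n)\<^sup>2)"
  shows "summable (\<lambda>n. f n * g n)"
proof (rule summable_comparison_test')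
  show "summable (\<lambda>n. (f n)\<^sup>2 + (g n)\<^sup>2)"
    using assms by (rule summable_add)
  show "norm (f n * g n) \<le> (f n)\<^sup>2 + (g n)\<^sup>2" for n
  proof -
    have "0 \<le> (\<bar>f n\<bar> - \<bar>g n\<bar>)\<^sup>2" by simp
    then have "2 * (\<bar>f n\<bar> * \<bar>g n\<bar>) \<le> (f n)\<^sup>2 + (g n)\<^sup>2"
      by (simp add: power2_diff)
    moreover have "0 \<le> \<bar>f n\<bar> * \<bar>g n\<bar>" by simp
    ultimately show ?thesis unfolding real_norm_def abs_mult by linarith
  qed
qed

lemma summable_ell2_add:
  fixes f g :: "nat \<Rightarrow> real"
  assumes "summable (\<lambda>n. (f n)\<^sup>2)" and "summable (\<lambda>n. (g n)\<^sup>2)"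
  shows "summable (\<lambda>n. (f n + g n)\<^sup>2)"
proof -
  have "summable (\<lambda>n. (f n)\<^sup>2 + (g n)\<^sup>2 + 2 * (f n * g n))"
    by (intro summable_add summable_mult summable_ell2_mult assms)
  then show ?thesis by (simp add: power2_sum algebra_simps)
qed

lemma summable_ell2_scale:
  fixes f :: "nat \<Rightarrow> real"
  assumes "summable (\<lambda>n. (f n)\<^sup>2)"
  shows "summable (\<lambda>n. (c * f n)\<^sup>2)"
  using summable_mult[OF assms, of "c\<^sup>2"] by (simp add: power_mult_distrib)

lemma summable_ell2_diff:
  fixes f g :: "nat \<Rightarrow> real"
  assumes "summable (\<lambda>n. (f n)\<^sup>2)" and "summable (\<lambda>n. (g n)\<^sup>2)"
  shows "summable (\<lambda>n. (f n - g n)\<^sup>2)"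
  using summable_ell2_add[OF assms(1) summable_ell2_scale[OF assms(2), of "-1"]] by simp

instantiation ell2 :: real_vector
begin

lift_definition zero_ell2 :: ell2 is "\<lambda>_. 0" by simp

lift_definition plus_ell2 :: "ell2 \<Rightarrow> ell2 \<Rightarrow> ell2" is "\<lambda>f g n. f n + g n"
  by (rule summable_ell2_add)

lift_definition minus_ell2 :: "ell2 \<Rightarrow> ell2 \<Rightarrow> ell2" is "\<lambda>f g n. f n - g n"
  by (rule summable_ell2_diff)

lift_definition uminus_ell2 :: "ell2 \<Rightarrow> ell2" is "\<lambda>f n. - f n" by simp

lift_definition scaleR_ell2 :: "real \<Rightarrow> ell2 \<Rightarrow> ell2" is "\<lambda>c f n. c * f n"
  by (rule summable_ell2_scale)

instance
  by standard (transfer; simp add: algebra_simps fun_eq_iff)+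

end

instantiation ell2 :: real_inner
begin

lift_definition inner_ell2 :: "ell2 \<Rightarrow> ell2 \<Rightarrow> real" is "\<lambda>f g. \<Sum>n. f n * g n" .

definition norm_ell2 :: "ell2 \<Rightarrow> real" where "norm_ell2 x = sqrt (x \<bullet> x)"

definition sgn_ell2 :: "ell2 \<Rightarrow> ell2" where "sgn_ell2 x = x /\<^sub>R norm x"

definition dist_ell2 :: "ell2 \<Rightarrow> ell2 \<Rightarrow> real" where "dist_ell2 x y = norm (x - y)"

definition uniformity_ell2 :: "(ell2 \<times> ell2) filter"
  where "uniformity_ell2 = (INF e\<in>{0 <..}. principal {(x, y). dist x y < e})"

definition open_ell2 :: "ell2 set \<Rightarrow> bool"
  where "open_ell2 S = (\<forall>x\<in>S. \<forall>\<^sub>F (x', y) in uniformity. x' = x \<longrightarrow> y \<in> S)"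

instance
proof
  fix x y z :: ell2 and r :: real
  show "x \<bullet> y = y \<bullet> x"
    by transfer (simp add: mult.commute)
  show "(x + y) \<bullet> z = x \<bullet> z + y \<bullet> z"
    by transfer (simp add: distrib_right suminf_add summable_ell2_mult)
  show "(r *\<^sub>R x) \<bullet> y = r * (x \<bullet> y)"
    by transfer (simp add: mult.assoc suminf_mult summable_ell2_mult)
  show "0 \<le> x \<bullet> x"
    by transfer (simp add: suminf_nonneg summable_ell2_mult)
  show "x \<bullet> x = 0 \<longleftrightarrow> x = 0"
    by transfer (simp add: suminf_eq_zero_iff summable_ell2_mult fun_eq_iff)
qed (simp_all add: norm_ell2_def sgn_ell2_def dist_ell2_def uniformity_ell2_def open_ell2_def)

end

lemma summable_ell2_nth: "summable (\<lambda>n. (ell2_nth x n)\<^sup>2)"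
  using ell2_nth by simp

lemma ell2_nth_diff: "ell2_nth (x - y) n = ell2_nth x n - ell2_nth y n"
  by transfer simp

lemma power2_norm_ell2: "(norm x)\<^sup>2 = (\<Sum>n. (ell2_nth x n)\<^sup>2)"
  unfolding power2_norm_eq_inner by transfer (simp add: power2_eq_square)

lemma sum_le_power2_norm_ell2:
  assumes "finite I"
  shows "(\<Sum>n\<in>I. (ell2_nth x n)\<^sup>2) \<le> (norm x)\<^sup>2"
  unfolding power2_norm_ell2 by (rule sum_le_suminf[OF summable_ell2_nth assms]) simp

lemma abs_ell2_nth_le_norm: "\<bar>ell2_nth x n\<bar> \<le> norm x"
  using sum_le_power2_norm_ell2[of "{n}" x] by (simp add: abs_le_square_iff[symmetric])

instance ell2 :: complete_space
proof
  fix X :: "nat \<Rightarrow> ell2"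
  assume C: "Cauchy X"
  have "Cauchy (\<lambda>k. ell2_nth (X k) n)" for n
  proof (rule metric_CauchyI)
    fix e :: real assume "0 < e"
    then obtain K where K: "\<And>m k. m \<ge> K \<Longrightarrow> k \<ge> K \<Longrightarrow> dist (X m) (X k) < e"
      using metric_CauchyD[OF C] by blast
    have "dist (ell2_nth (X m) n) (ell2_nth (X k) n) < e" if "m \<ge> K" "k \<ge> K" for m k
      using abs_ell2_nth_le_norm[of "X m - X k" n] K[OF that]
      by (simp add: dist_norm ell2_nth_diff)
    then show "\<exists>K. \<forall>m\<ge>K. \<forall>k\<ge>K. dist (ell2_nth (X m) n) (ell2_nth (X k) n) < e"
      by blast
  qed
  then have "\<exists>l. (\<lambda>k. ell2_nth (X k) n) \<longlonglongrightarrow> l" for n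
    using Cauchy_convergent convergent_def by blast
  then obtain g where g: "\<And>n. (\<lambda>k. ell2_nth (X k) n) \<longlonglongrightarrow> g n"
    by metis
  have bound: "\<exists>K. \<forall>m\<ge>K. \<forall>j. (\<Sum>i<j. (ell2_nth (X m) i - g i)\<^sup>2) \<le> e\<^sup>2" if "0 < e" for e :: real
  proof -
    obtain K where K: "\<And>m k. m \<ge> K \<Longrightarrow> k \<ge> K \<Longrightarrow> dist (X m) (X k) < e"
      using metric_CauchyD[OF C \<open>0 < e\<close>] by blast
    have "(\<Sum>i<j. (ell2_nth (X m) i - g i)\<^sup>2) \<le> e\<^sup>2" if "m \<ge> K" for m j
    proof (rule LIMSEQ_le_const2)
      show "(\<lambda>k. \<Sum>i<j. (ell2_nth (X m) i - ell2_nth (X k) i)\<^sup>2)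
              \<longlonglongrightarrow> (\<Sum>i<j. (ell2_nth (X m) i - g i)\<^sup>2)"
        by (intro tendsto_intros g)
      have "(\<Sum>i<j. (ell2_nth (X m) i - ell2_nth (X k) i)\<^sup>2) \<le> e\<^sup>2" if "k \<ge> K" for k
      proof -
        have "(\<Sum>i<j. (ell2_nth (X m) i - ell2_nth (X k) i)\<^sup>2) \<le> (norm (X m - X k))\<^sup>2"
          using sum_le_power2_norm_ell2[of "{..<j}" "X m - X k"] by (simp add: ell2_nth_diff)
        also have "\<dots> \<le> e\<^sup>2"
          using K[OF \<open>m \<ge> K\<close> that] by (simp add: dist_norm power_mono)
        finally show ?thesis .
      qed
      then show "\<exists>N. \<forall>k\<ge>N. (\<Sum>i<j. (ell2_nth (X m) i - ell2_nth (X k) i)\<^sup>2) \<le> e\<^sup>2"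
        by blast
    qed
    then show ?thesis by blast
  qed
  have diff: "summable (\<lambda>i. (ell2_nth (X m) i - g i)\<^sup>2)"
    if "\<forall>j. (\<Sum>i<j. (ell2_nth (X m) i - g i)\<^sup>2) \<le> c" for m c
    using that by (intro summableI_nonneg_bounded[where x = c]) auto
  obtain K where K: "\<forall>j. (\<Sum>i<j. (ell2_nth (X K) i - g i)\<^sup>2) \<le> 1\<^sup>2"
    using bound[of 1] by auto
  have "summable (\<lambda>i. (g i)\<^sup>2)"
    using summable_ell2_diff[OF summable_ell2_nth diff[OF K], of "X K"] by simp
  then obtain L where L: "ell2_nth L = g"
    using Abs_ell2_inverse by blast
  have "X \<longlonglongrightarrow> L"
  proof (rule metric_LIMSEQ_I)
    fix e :: real assume "0 < e"
    then obtain K where K: "\<And>m j. m \<ge> K \<Longrightarrow> (\<Sum>i<j. (ell2_nth (X m) i - g i)\<^sup>2) \<le> (e/2)\<^sup>2"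
      using bound[of "e/2"] by auto
    have "dist (X m) L < e" if "m \<ge> K" for m
    proof -
      have "(norm (X m - L))\<^sup>2 \<le> (e/2)\<^sup>2"
        unfolding power2_norm_ell2 ell2_nth_diff L
        using K[OF that] by (intro suminf_le_const diff) auto
      then have "norm (X m - L) \<le> e/2"
        by (rule power2_le_imp_le) (use \<open>0 < e\<close> in simp)
      then show ?thesis using \<open>0 < e\<close> by (simp add: dist_norm)
    qed
    then show "\<exists>K. \<forall>m\<ge>K. dist (X m) L < e" by blast
  qed
  then show "convergent X" by (auto simp: convergent_def)
qed

instance ell2 :: polish_space
proof
  define s :: "rat list \<Rightarrow> nat \<Rightarrow> real"
    where "s qs n = (if n < length qs then of_rat (qs ! n) else 0)" for qs n
  define D where "D = range (\<lambda>qs. Abs_ell2 (s qs))"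
  have s: "ell2_nth (Abs_ell2 (s qs)) = s qs" for qs
  proof (rule Abs_ell2_inverse)
    show "s qs \<in> {f. summable (\<lambda>n. (f n)\<^sup>2)}"
      using summable_finite[of "{..<length qs}" "\<lambda>n. (s qs n)\<^sup>2"] by (simp add: s_def)
  qed
  have dense: "\<exists>d\<in>D. dist x d < e" if "0 < e" for x e
  proof -
    have "(\<lambda>N. \<Sum>n. (ell2_nth x (n + N))\<^sup>2) \<longlonglongrightarrow> 0"
      by (rule suminf_exist_split2[OF summable_ell2_nth])
    then have "\<forall>\<^sub>F N in sequentially. (\<Sum>n. (ell2_nth x (n + N))\<^sup>2) < e\<^sup>2/2"
      using \<open>0 < e\<close> by (intro order_tendstoD) auto
    then obtain N where N: "(\<Sum>n. (ell2_nth x (n + N))\<^sup>2) < e\<^sup>2/2"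
      using eventually_happens by force
    define \<delta> where "\<delta> = sqrt (e\<^sup>2 / (2 * (real N + 1)))"
    have "0 < \<delta>" using \<open>0 < e\<close> by (simp add: \<delta>_def)
    then have "\<exists>q. \<bar>ell2_nth x n - of_rat q\<bar> < \<delta>" for n
      using of_rat_dense[of "ell2_nth x n - \<delta>" "ell2_nth x n + \<delta>"] by (auto simp: abs_less_iff) (smt (verit))
    then obtain q where q: "\<And>n. \<bar>ell2_nth x n - of_rat (q n)\<bar> < \<delta>"
      by metis
    define d where "d = Abs_ell2 (s (map q [0..<N]))"
    have d: "ell2_nth d n = (if n < N then of_rat (q n) else 0)" for n
      unfolding d_def s by (simp add: s_def)
    have "(norm (x - d))\<^sup>2 = (\<Sum>n. (ell2_nth (x - d) (n + N))\<^sup>2) + (\<Sum>n<N. (ell2_nth (x - d) n)\<^sup>2)"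
      unfolding power2_norm_ell2 by (rule suminf_split_initial_segment[OF summable_ell2_nth])
    also have "(\<Sum>n. (ell2_nth (x - d) (n + N))\<^sup>2) < e\<^sup>2/2"
      using N by (simp add: ell2_nth_diff d)
    also have "(\<Sum>n<N. (ell2_nth (x - d) n)\<^sup>2) \<le> (\<Sum>n<N. \<delta>\<^sup>2)"
    proof (rule sum_mono)
      fix n assume "n \<in> {..<N}"
      then show "(ell2_nth (x - d) n)\<^sup>2 \<le> \<delta>\<^sup>2"
        using q[of n] \<open>0 < \<delta>\<close> by (simp add: ell2_nth_diff d abs_le_square_iff[symmetric])
    qed
    also have "(\<Sum>n<N. \<delta>\<^sup>2) \<le> e\<^sup>2/2"
      using \<open>0 < e\<close> by (simp add: \<delta>_def field_simps)
    finally have "(norm (x - d))\<^sup>2 < e\<^sup>2" by simp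
    then have "norm (x - d) < e"
      by (rule power2_less_imp_less) (use \<open>0 < e\<close> in simp)
    then show ?thesis
      unfolding D_def d_def dist_norm by blast
  qed
  define B where "B = (\<lambda>(d, q). ball d (of_rat q)) ` (D \<times> (UNIV :: rat set))"
  have "countable B"
    unfolding B_def D_def by (intro countable_image countable_SIGMA countableI_type)
  moreover have "topological_basis B"
  proof (rule topological_basisI)
    fix O' and x :: ell2 assume "open O'" "x \<in> O'"
    then obtain e where e: "0 < e" "ball x e \<subseteq> O'"
      using openE by blast
    obtain q where q: "e/3 < of_rat q" "of_rat q < e/2"
      using of_rat_dense[of "e/3" "e/2"] e by auto
    obtain d where d: "d \<in> D" "dist x d < e/3"
      using dense[of "e/3" x] e by auto
    have "ball d (of_rat q) \<subseteq> ball x e"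
    proof
      fix y assume "y \<in> ball d (of_rat q)"
      then show "y \<in> ball x e"
        using q d e dist_triangle[of x y d] by simp
    qed
    moreover have "x \<in> ball d (of_rat q)"
      using q d by (simp add: dist_commute)
    moreover have "ball d (of_rat q) \<in> B"
      unfolding B_def using d by force
    ultimately show "\<exists>B'\<in>B. x \<in> B' \<and> B' \<subseteq> O'"
      using e by blast
  qed (auto simp: B_def)
  ultimately show "\<exists>B :: ell2 set set. countable B \<and> open = generate_topology B"
    using topological_basis_imp_subbasis by blast
qed


section \<open>Fuzzy metric spaces\<close>

locale continuous_t_norm =
  fixes tnorm :: "real \<Rightarrow> real \<Rightarrow> real"
  assumes tnorm_closed: "a \<in> {0..1} \<Longrightarrow> b \<in> {0..1} \<Longrightarrow> tnorm a b \<in> {0..1}"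
    and tnorm_assoc: "a \<in> {0..1} \<Longrightarrow> b \<in> {0..1} \<Longrightarrow> c \<in> {0..1} \<Longrightarrow>
          tnorm (tnorm a b) c = tnorm a (tnorm b c)"
    and tnorm_commute: "a \<in> {0..1} \<Longrightarrow> b \<in> {0..1} \<Longrightarrow> tnorm a b = tnorm b a"
    and tnorm_one: "a \<in> {0..1} \<Longrightarrow> tnorm a 1 = a"
    and tnorm_mono: "a \<in> {0..1} \<Longrightarrow> b \<in> {0..1} \<Longrightarrow> c \<in> {0..1} \<Longrightarrow> d \<in> {0..1} \<Longrightarrow>
          a \<le> c \<Longrightarrow> b \<le> d \<Longrightarrow> tnorm a b \<le> tnorm c d"
    and tnorm_continuous: "continuous_on ({0..1} \<times> {0..1}) (\<lambda>(a, b). tnorm a b)"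

definition tnorm_no_zero_divisors :: "(real \<Rightarrow> real \<Rightarrow> real) \<Rightarrow> bool" where
  "tnorm_no_zero_divisors tnorm \<longleftrightarrow>
     (\<forall>a\<in>{0..1}. \<forall>b\<in>{0..1}. a \<noteq> 0 \<longrightarrow> b \<noteq> 0 \<longrightarrow> tnorm a b \<noteq> 0)"

text \<open>The values of \<open>M x y t\<close> outside \<open>x, y \<in> X\<close>, \<open>t > 0\<close> are irrelevant, as are those of
  the t-norm outside the unit square.\<close>

locale fuzzy_metric_space = continuous_t_norm tnorm
  for X :: "'a set" and M :: "'a \<Rightarrow> 'a \<Rightarrow> real \<Rightarrow> real" and tnorm :: "real \<Rightarrow> real \<Rightarrow> real" +
  assumes fm_range: "x \<in> X \<Longrightarrow> y \<in> X \<Longrightarrow> 0 < t \<Longrightarrow> M x y t \<in> {0..1}"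
    and fm_pos: "x \<in> X \<Longrightarrow> y \<in> X \<Longrightarrow> 0 < t \<Longrightarrow> 0 < M x y t"
    and fm_eq_one_iff: "x \<in> X \<Longrightarrow> y \<in> X \<Longrightarrow> 0 < t \<Longrightarrow> M x y t = 1 \<longleftrightarrow> x = y"
    and fm_sym: "x \<in> X \<Longrightarrow> y \<in> X \<Longrightarrow> 0 < t \<Longrightarrow> M x y t = M y x t"
    and fm_triangle: "x \<in> X \<Longrightarrow> y \<in> X \<Longrightarrow> z \<in> X \<Longrightarrow> 0 < t \<Longrightarrow> 0 < s \<Longrightarrow>
          tnorm (M x y t) (M y z s) \<le> M x z (t + s)"
    and fm_continuous: "x \<in> X \<Longrightarrow> y \<in> X \<Longrightarrow> continuous_on {0<..} (M x y)"

definition standard_fuzzy_metric :: "('a \<Rightarrow> 'a \<Rightarrow> real) \<Rightarrow> 'a \<Rightarrow> 'a \<Rightarrow> real \<Rightarrow> real" where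
  "standard_fuzzy_metric d x y t = t / (t + d x y)"

definition fuzzy_ball ::
    "'a set \<Rightarrow> ('a \<Rightarrow> 'a \<Rightarrow> real \<Rightarrow> real) \<Rightarrow> 'a \<Rightarrow> real \<Rightarrow> real \<Rightarrow> 'a set" where
  "fuzzy_ball X M x r t = {y \<in> X. M x y t > 1 - r}"

text \<open>Finiteness of the balls is part of the cardinality bound; it has to be stated separately
  because \<^const>\<open>card\<close> is \<open>0\<close> on infinite sets.\<close>

definition uniformly_locally_finite ::
    "'a set \<Rightarrow> ('a \<Rightarrow> 'a \<Rightarrow> real \<Rightarrow> real) \<Rightarrow> bool" where
  "uniformly_locally_finite X M \<longleftrightarrow>
     (\<forall>r\<in>{0<..<1}. \<forall>t>0. \<exists>N::nat. N > 0 \<and>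
        (\<forall>x\<in>X. finite (fuzzy_ball X M x r t) \<and> card (fuzzy_ball X M x r t) < N))"

definition property_A :: "'a set \<Rightarrow> ('a \<Rightarrow> 'a \<Rightarrow> real \<Rightarrow> real) \<Rightarrow> bool" where
  "property_A X M \<longleftrightarrow>
     (\<forall>\<epsilon>>0. \<forall>t>0. \<forall>r\<in>{0<..<1}. \<exists>t'>0. \<exists>r'\<in>{0<..<1}. \<exists>A :: 'a \<Rightarrow> ('a \<times> nat) set.
        (\<forall>x\<in>X. A x \<noteq> {} \<and> finite (A x) \<and> A x \<subseteq> fuzzy_ball X M x r' t' \<times> UNIV) \<and>
        (\<forall>x\<in>X. \<forall>y\<in>X. M x y t > 1 - r \<longrightarrow>
           real (card (sym_diff (A x) (A y))) < \<epsilon> * real (card (A x \<inter> A y))))"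

definition uniformly_expansive ::
    "'a set \<Rightarrow> ('a \<Rightarrow> 'a \<Rightarrow> real \<Rightarrow> real) \<Rightarrow> ('b \<Rightarrow> 'b \<Rightarrow> real \<Rightarrow> real) \<Rightarrow> ('a \<Rightarrow> 'b) \<Rightarrow> bool" where
  "uniformly_expansive X M\<^sub>1 M\<^sub>2 f \<longleftrightarrow>
     (\<forall>A>0. \<forall>t>0. \<exists>B\<in>{0<..<1}. \<exists>t'>0. \<forall>x\<in>X. \<forall>x'\<in>X.
        M\<^sub>1 x x' t \<ge> A \<longrightarrow> M\<^sub>2 (f x) (f x') t' \<ge> B)"

definition effectively_proper ::
    "'a set \<Rightarrow> ('a \<Rightarrow> 'a \<Rightarrow> real \<Rightarrow> real) \<Rightarrow> ('b \<Rightarrow> 'b \<Rightarrow> real \<Rightarrow> real) \<Rightarrow> ('a \<Rightarrow> 'b) \<Rightarrow> bool" where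
  "effectively_proper X M\<^sub>1 M\<^sub>2 f \<longleftrightarrow>
     (\<forall>C>0. \<forall>t>0. \<exists>D\<in>{0<..<1}. \<exists>t'>0. \<forall>x\<in>X. \<forall>x'\<in>X.
        M\<^sub>2 (f x) (f x') t \<ge> C \<longrightarrow> M\<^sub>1 x x' t' \<ge> D)"

definition coarse_embedding ::
    "'a set \<Rightarrow> ('a \<Rightarrow> 'a \<Rightarrow> real \<Rightarrow> real) \<Rightarrow> 'b set \<Rightarrow> ('b \<Rightarrow> 'b \<Rightarrow> real \<Rightarrow> real) \<Rightarrow> ('a \<Rightarrow> 'b) \<Rightarrow> bool" where
  "coarse_embedding X M\<^sub>1 Y M\<^sub>2 f \<longleftrightarrow>
     f \<in> X \<rightarrow> Y \<and> uniformly_expansive X M\<^sub>1 M\<^sub>2 f \<and> effectively_proper X M\<^sub>1 M\<^sub>2 f"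

text \<open>The t-norm of a fuzzy metric space plays no role in the notion of coarse embedding; that
  of the standard fuzzy metric space is the product.\<close>

lemma fuzzy_metric_space_standard:
  "fuzzy_metric_space (UNIV :: 'b::metric_space set) (standard_fuzzy_metric dist) (*)"
proof
  show "continuous_on ({0..1} \<times> {0..1}) (\<lambda>(a, b). a * b :: real)"
    unfolding case_prod_beta by (intro continuous_intros)
  fix x y z :: 'b and t s :: real
  assume t: "0 < t"
  have p: "0 < t + dist x y" for x y :: 'b using t by (simp add: add_pos_nonneg)
  show "standard_fuzzy_metric dist x y t \<in> {0..1}" "0 < standard_fuzzy_metric dist x y t"
    "standard_fuzzy_metric dist x y t = 1 \<longleftrightarrow> x = y"
    using p[of x y] t by (auto simp: standard_fuzzy_metric_def)
  show "standard_fuzzy_metric dist x y t = standard_fuzzy_metric dist y x t"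
    by (simp add: standard_fuzzy_metric_def dist_commute)
  assume s: "0 < s"
  define a b c where "a = dist x y" and "b = dist y z" and "c = dist x z"
  have abc: "0 \<le> a" "0 \<le> b" "0 \<le> c" "c \<le> a + b"
    unfolding a_def b_def c_def by (simp_all add: dist_triangle)
  have "t * s * c \<le> t * s * (a + b)"
    using abc s t by (intro mult_left_mono) auto
  also have "\<dots> \<le> (t + s) * (t * b + s * a + a * b)"
  proof -
    have "0 \<le> t * t * b" "0 \<le> s * s * a" "0 \<le> (t + s) * (a * b)"
      using abc s t by simp_all
    then show ?thesis by (simp add: algebra_simps)
  qed
  finally have "(t * s) * (t + s + c) \<le> (t + s) * ((t + a) * (s + b))"
    by (simp add: algebra_simps)
  then have "(t * s) / ((t + a) * (s + b)) \<le> (t + s) / (t + s + c)"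
    using abc s t by (simp add: divide_simps add_pos_nonneg)
  then show "standard_fuzzy_metric dist x y t * standard_fuzzy_metric dist y z s
      \<le> standard_fuzzy_metric dist x z (t + s)"
    by (simp add: standard_fuzzy_metric_def a_def b_def c_def)
next
  fix x y :: 'b
  show "continuous_on {0<..} (standard_fuzzy_metric dist x y)"
    unfolding standard_fuzzy_metric_def
    by (intro continuous_intros) (metis add_pos_nonneg greaterThan_iff less_irrefl zero_le_dist)
qed (auto intro: mult_mono mult_le_one)

end

theory Submission
  imports Defs
begin

text \<open>
  This is Yu's construction. Property A at level \<open>n\<close>, with \<open>t = n + 1\<close>, \<open>1 - r = 1/(n + 2)\<close> and
  \<open>\<epsilon> = 2\<^sup>-\<^sup>n\<close>, gives finite sets \<open>A n x\<close>. Let \<open>\<xi> n x\<close> be the unit vector obtained by normalising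
  the indicator of \<open>A n x\<close>, and map \<open>x\<close> to the direct sum over \<open>n\<close> of \<open>\<xi> n x - \<xi> n x0\<close>. If
  \<open>M x y t \<ge> a > 0\<close>, then for all large \<open>n\<close> the \<open>n\<close>-th component of the difference of the images has
  square norm at most \<open>2 \<epsilon>\<close>, which gives convergence and a uniform bound. If \<open>A n x\<close> and \<open>A n y\<close>
  are disjoint, this square norm is \<open>2\<close>; so a bound on the distance of the images forces
  \<open>A n x\<close> and \<open>A n y\<close> to meet for some \<open>n\<close> below a fixed bound, and then the triangle inequality
  bounds \<open>M x y (2 t')\<close> from below by a product that is positive for lack of zero divisors.
  Separability costs nothing, since \<open>X\<close> is countable.\<close>

section \<open>Square-summable families as points of \<open>ell2\<close>\<close>

text \<open>Coordinates are moved to \<open>nat\<close> along \<open>to_nat_on J\<close>, with zeros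
  off its image, so that finite \<open>J\<close> is covered too. The conclusion speaks of distances
  only, which hides the encoding from later arguments.\<close>

lemma countable_family_to_ell2:
  fixes F :: "'a \<Rightarrow> 'j \<Rightarrow> real"
  assumes J: "countable J"
    and F: "\<And>x. x \<in> X \<Longrightarrow> (\<lambda>j. (F x j)\<^sup>2) summable_on J"
  shows "\<exists>f :: 'a \<Rightarrow> ell2. \<forall>x\<in>X. \<forall>y\<in>X.
    ((\<lambda>j. (F x j - F y j)\<^sup>2) has_sum (dist (f x) (f y))\<^sup>2) J"
proof -
  let ?e = "to_nat_on J"
  define G where "G x m = (if m \<in> ?e ` J then F x (the_inv_into J ?e m) else 0)" for x m
  define f where "f x = Abs_ell2 (G x)" for x
  have inj: "inj_on ?e J" using J by (rule inj_on_to_nat_on)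
  have G_e: "G x (?e j) = F x j" if "j \<in> J" for x j
    using that inj by (simp add: G_def the_inv_into_f_f)
  have "((\<lambda>m. (G x m)\<^sup>2) has_sum S) UNIV" if "((\<lambda>j. (F x j)\<^sup>2) has_sum S) J" for x S
  proof -
    have "((\<lambda>j. (G x (?e j))\<^sup>2) has_sum S) J"
      using that by (rule has_sum_cong[THEN iffD1, rotated]) (simp add: G_e)
    then have "((\<lambda>m. (G x m)\<^sup>2) has_sum S) (?e ` J)"
      by (simp add: has_sum_reindex[OF inj] o_def)
    then show ?thesis
      by (rule has_sum_cong_neutral[THEN iffD1, rotated -1]) (auto simp: G_def)
  qed
  then have "summable (\<lambda>m. (G x m)\<^sup>2)" if "x \<in> X" for x
    using F[OF that] by (meson has_sum_imp_sums summable_on_def sums_summable)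
  then have nth: "ell2_nth (f x) = G x" if "x \<in> X" for x
    unfolding f_def using that by (intro Abs_ell2_inverse) simp
  have "((\<lambda>j. (F x j - F y j)\<^sup>2) has_sum (dist (f x) (f y))\<^sup>2) J" if xy: "x \<in> X" "y \<in> X" for x y
  proof -
    have "(\<lambda>m. (ell2_nth (f x - f y) m)\<^sup>2) sums (dist (f x) (f y))\<^sup>2"
      unfolding dist_norm power2_norm_ell2 by (rule summable_sums[OF summable_ell2_nth])
    then have "((\<lambda>m. (G x m - G y m)\<^sup>2) has_sum (dist (f x) (f y))\<^sup>2) UNIV"
      by (simp add: ell2_nth_diff nth xy sums_nonneg_imp_has_sum)
    then have "((\<lambda>m. (G x m - G y m)\<^sup>2) has_sum (dist (f x) (f y))\<^sup>2) (?e ` J)"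
      by (rule has_sum_cong_neutral[THEN iffD1, rotated -1]) (auto simp: G_def)
    then have "((\<lambda>j. (G x (?e j) - G y (?e j))\<^sup>2) has_sum (dist (f x) (f y))\<^sup>2) J"
      by (simp add: has_sum_reindex[OF inj] o_def)
    then show ?thesis
      by (rule has_sum_cong[THEN iffD1, rotated]) (simp add: G_e)
  qed
  then show ?thesis by blast
qed

text \<open>Only the differences are assumed summable over \<open>n\<close>, not the vectors
  \<open>u n x\<close> themselves. Subtracting a base point repairs this and cancels in every
  difference.\<close>

lemma direct_sum_to_ell2:
  fixes u :: "nat \<Rightarrow> 'a \<Rightarrow> 'i \<Rightarrow> real"
  assumes I: "countable I"
    and u: "\<And>n x y. x \<in> X \<Longrightarrow> y \<in> X \<Longrightarrow> ((\<lambda>k. (u n x k - u n y k)\<^sup>2) has_sum q n x y) I"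
    and q: "\<And>x y. x \<in> X \<Longrightarrow> y \<in> X \<Longrightarrow> summable (\<lambda>n. q n x y)"
  shows "\<exists>f :: 'a \<Rightarrow> ell2. \<forall>x\<in>X. \<forall>y\<in>X. (\<lambda>n. q n x y) sums (dist (f x) (f y))\<^sup>2"
proof (cases "X = {}")
  case False
  then obtain x0 where x0: "x0 \<in> X" by blast
  define F where "F x = (\<lambda>(n, k). u n x k - u n x0 k)" for x
  have hs: "((\<lambda>j. (F x j - F y j)\<^sup>2) has_sum (\<Sum>n. q n x y)) (UNIV \<times> I)"
    if "x \<in> X" "y \<in> X" for x y
  proof -
    have q0: "0 \<le> q n x y" for n
      using u[OF that, of n] by (rule has_sum_nonneg) simp
    have *: "((\<lambda>n. q n x y) has_sum (\<Sum>n. q n x y)) UNIV"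
      by (rule sums_nonneg_imp_has_sum[OF summable_sums[OF q[OF that]] q0])
    have inner: "((\<lambda>k. (F x (n, k) - F y (n, k))\<^sup>2) has_sum q n x y) I" for n
      using u[OF that, of n] by (simp add: F_def)
    have "(\<lambda>j. (F x j - F y j)\<^sup>2) summable_on UNIV \<times> I"
      using inner * by (intro summable_on_SigmaI) (auto simp: summable_on_def)
    then show ?thesis
      by (rule has_sum_SigmaI[OF inner *])
  qed
  \<comment> \<open>Hence \<open>hs\<close> against \<open>x0\<close> is square-summability of
    \<open>F x\<close> itself.\<close>
  have "F x0 = (\<lambda>_. 0)" by (auto simp: F_def)
  then have "(\<lambda>j. (F x j)\<^sup>2) summable_on UNIV \<times> I" if "x \<in> X" for x
    using hs[OF that x0] by (auto simp: summable_on_def)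
  moreover have "countable ((UNIV :: nat set) \<times> I)" using I by simp
  ultimately obtain f :: "'a \<Rightarrow> ell2" where f:
    "\<And>x y. x \<in> X \<Longrightarrow> y \<in> X \<Longrightarrow> ((\<lambda>j. (F x j - F y j)\<^sup>2) has_sum (dist (f x) (f y))\<^sup>2) (UNIV \<times> I)"
    using countable_family_to_ell2[of "(UNIV :: nat set) \<times> I" X F] by blast
  have "(\<lambda>n. q n x y) sums (dist (f x) (f y))\<^sup>2" if "x \<in> X" "y \<in> X" for x y
    using has_sum_unique[OF f[OF that] hs[OF that]] summable_sums[OF q[OF that]] by simp
  then show ?thesis by blast
qed simp

section \<open>Normalised indicators of finite sets\<close>

definition unit_indicator :: "'i set \<Rightarrow> 'i \<Rightarrow> real" where
  "unit_indicator S k = indicator S k / sqrt (card S)"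

text \<open>For nonempty finite sets: 1 + 1 minus twice the inner product of the two unit
  vectors.\<close>

definition unit_indicator_sqdist :: "'i set \<Rightarrow> 'i set \<Rightarrow> real" where
  "unit_indicator_sqdist S T = 2 - 2 * card (S \<inter> T) / sqrt (real (card S) * real (card T))"

lemma has_sum_unit_indicator_diff:
  assumes S: "finite S" "S \<noteq> {}" "S \<subseteq> I" and T: "finite T" "T \<noteq> {}" "T \<subseteq> I"
  shows "((\<lambda>k. (unit_indicator S k - unit_indicator T k)\<^sup>2) has_sum unit_indicator_sqdist S T) I"
proof -
  let ?a = "real (card S)" and ?b = "real (card T)"
  let ?d = "\<lambda>k. (unit_indicator S k - unit_indicator T k)\<^sup>2"
  have pos: "0 < ?a" "0 < ?b" using S T by (simp_all add: card_gt_0_iff)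
  have ind: "(\<Sum>k\<in>S \<union> T. indicator V k) = real (card V)" if "V \<subseteq> S \<union> T" for V
    using sum.mono_neutral_cong_right[of "S \<union> T" V "indicator V" "\<lambda>_. 1 :: real"] S T that by simp
  have "?d k = indicator S k / ?a + indicator T k / ?b - 2 * indicator (S \<inter> T) k / sqrt (?a * ?b)" for k
    using pos by (auto simp: unit_indicator_def indicator_def power2_diff power_divide real_sqrt_mult)
  then have "sum ?d (S \<union> T) = (\<Sum>k\<in>S \<union> T. indicator S k) / ?a + (\<Sum>k\<in>S \<union> T. indicator T k) / ?b
      - 2 * (\<Sum>k\<in>S \<union> T. indicator (S \<inter> T) k) / sqrt (?a * ?b)"
    by (simp add: sum.distrib sum_subtractf sum_divide_distrib sum_distrib_left)
  also have "\<dots> = unit_indicator_sqdist S T"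
    using pos by (simp add: ind le_infI1 unit_indicator_sqdist_def)
  finally have "(?d has_sum unit_indicator_sqdist S T) (S \<union> T)"
    using has_sum_finite[of "S \<union> T" ?d] S T by simp
  then show ?thesis
    by (rule has_sum_cong_neutral[THEN iffD1, rotated -1])
      (use S T in \<open>auto simp: unit_indicator_def\<close>)
qed

lemma unit_indicator_sqdist_nonneg:
  assumes "finite S" "S \<noteq> {}" "finite T" "T \<noteq> {}"
  shows "0 \<le> unit_indicator_sqdist S T"
  using has_sum_unit_indicator_diff[of S UNIV T] assms by (auto intro: has_sum_nonneg)

lemma unit_indicator_sqdist_le_2: "unit_indicator_sqdist S T \<le> 2"
  by (simp add: unit_indicator_sqdist_def)

lemma unit_indicator_sqdist_disjoint: "S \<inter> T = {} \<Longrightarrow> unit_indicator_sqdist S T = 2"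
  by (simp add: unit_indicator_sqdist_def)

text \<open>Both cardinalities are at most \<open>1 + e\<close> times that of the intersection, so
  the inner product is at least \<open>1 / (1 + e)\<close>, hence at least \<open>1 - e\<close>.
  Strictness in the hypothesis forces the intersection to be nonempty.\<close>

lemma unit_indicator_sqdist_le:
  assumes S: "finite S" and T: "finite T" and e: "0 < e"
    and *: "real (card (sym_diff S T)) < e * real (card (S \<inter> T))"
  shows "unit_indicator_sqdist S T \<le> 2 * e"
proof -
  let ?a = "real (card S)" and ?b = "real (card T)" and ?c = "real (card (S \<inter> T))"
  have "0 < e * ?c" using * by linarith
  then have c: "0 < ?c" using e by (simp add: zero_less_mult_iff)
  have sub: "card S \<le> card (S \<inter> T \<union> sym_diff S T)" "card T \<le> card (S \<inter> T \<union> sym_diff S T)"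
    "card (S \<inter> T) \<le> card S" "card (S \<inter> T) \<le> card T"
    using S T by (auto intro!: card_mono)
  then have "card S \<le> card (S \<inter> T) + card (sym_diff S T)" "card T \<le> card (S \<inter> T) + card (sym_diff S T)"
    using card_Un_le[of "S \<inter> T" "sym_diff S T"] by linarith+
  then have ab: "?a \<le> (1 + e) * ?c" "?b \<le> (1 + e) * ?c"
    using * by (simp_all add: algebra_simps)
  have "?a * ?b \<le> ((1 + e) * ?c)\<^sup>2"
    unfolding power2_eq_square using ab c e by (intro mult_mono) auto
  then have "sqrt (?a * ?b) \<le> (1 + e) * ?c"
    using c e by (intro real_le_lsqrt) auto
  moreover have "0 < sqrt (?a * ?b)" using sub c by simp
  ultimately have "1 / (1 + e) \<le> ?c / sqrt (?a * ?b)"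
    using e c by (simp add: field_simps)
  moreover have "1 - e \<le> 1 / (1 + e)"
    using e by (simp add: field_simps)
  ultimately show ?thesis
    unfolding unit_indicator_sqdist_def by (simp add: field_simps)
qed

section \<open>Fuzzy metric spaces\<close>

context fuzzy_metric_space
begin

text \<open>Triangle inequality through \<open>y\<close> itself: the remaining time
  \<open>t - s\<close> contributes \<open>M y y (t - s) = 1\<close>, the unit of the t-norm.\<close>

lemma fm_mono:
  assumes "x \<in> X" "y \<in> X" "0 < s" "s \<le> t"
  shows "M x y s \<le> M x y t"
proof (cases "s = t")
  case False
  then have "0 < t - s" using assms by simp
  then have "tnorm (M x y s) 1 \<le> M x y t"
    using fm_triangle[of x y y s "t - s"] fm_eq_one_iff[of y y "t - s"] assms by simp
  then show ?thesis using tnorm_one[OF fm_range] assms by simp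
qed simp

lemma fm_common_neighbour:
  assumes "x \<in> X" "y \<in> X" "z \<in> X" "0 < t" "0 \<le> a" "a \<le> M x z t" "a \<le> M y z t"
  shows "tnorm a a \<le> M x y (t + t)"
proof -
  have "M x z t \<le> 1" "M z y t \<le> 1" "M z y t = M y z t"
    using fm_range[of x z t] fm_range[of z y t] fm_sym[of z y t] assms by auto
  then have "tnorm a a \<le> tnorm (M x z t) (M z y t)"
    using assms by (intro tnorm_mono) auto
  also have "\<dots> \<le> M x y (t + t)" using assms by (intro fm_triangle)
  finally show ?thesis .
qed

text \<open>By positivity of \<open>M\<close>, the balls about one point with radii tending to 1
  exhaust \<open>X\<close>, and each is finite. The offset 2 keeps the radius positive at
  \<open>n = 0\<close>.\<close>

lemma countable_if_uniformly_locally_finite: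
  assumes "uniformly_locally_finite X M"
  shows "countable X"
proof (cases "X = {}")
  case False
  then obtain x0 where x0: "x0 \<in> X" by blast
  have "X \<subseteq> (\<Union>n::nat. fuzzy_ball X M x0 (1 - 1 / (real n + 2)) 1)"
  proof
    fix y assume y: "y \<in> X"
    obtain n where "1 / real (Suc n) < M x0 y 1"
      using nat_approx_posE[OF fm_pos[OF x0 y]] zero_less_one by metis
    moreover have "1 / (real n + 2) \<le> 1 / real (Suc n)" by (simp add: field_simps)
    ultimately show "y \<in> (\<Union>n::nat. fuzzy_ball X M x0 (1 - 1 / (real n + 2)) 1)"
      using y by (auto simp: fuzzy_ball_def intro!: exI[of _ n])
  qed
  moreover have "finite (fuzzy_ball X M x0 (1 - 1 / (real n + 2)) 1)" for n
  proof -
    have "1 - 1 / (real n + 2) \<in> {0<..<1}" by (simp add: field_simps)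
    then show ?thesis
      using assms x0 unfolding uniformly_locally_finite_def by (meson zero_less_one)
  qed
  ultimately show ?thesis
    by (meson countable_UN countable_finite countable_subset uncountable_def countableI_type)
qed simp

lemma coarse_embedding_ell2:
  assumes nzd: "tnorm_no_zero_divisors tnorm"
    and ctb: "countable X"
    and pA: "property_A X M"
  shows "\<exists>f :: 'a \<Rightarrow> ell2. coarse_embedding X M UNIV (standard_fuzzy_metric dist) f"
proof -
  \<comment> \<open>Bundles all data of one level, so that the three sequences are chosen
    together.\<close>
  define P where "P n t' r' A \<longleftrightarrow> 0 < t' \<and> 0 < r' \<and> r' < 1 \<and>
      (\<forall>x\<in>X. A x \<noteq> {} \<and> finite (A x) \<and> A x \<subseteq> fuzzy_ball X M x r' t' \<times> UNIV) \<and>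
      (\<forall>x\<in>X. \<forall>y\<in>X. M x y (real n + 1) > 1 / (real n + 2) \<longrightarrow>
         real (card (sym_diff (A x) (A y))) < (1 / 2) ^ n * real (card (A x \<inter> A y)))"
    for n t' r' and A :: "'a \<Rightarrow> ('a \<times> nat) set"
  have "\<exists>t' r' A. P n t' r' A" for n
  proof -
    define e t r where "e = (1 / 2 :: real) ^ n" and "t = real n + 1" and "r = 1 - 1 / (real n + 2)"
    have "e > 0" "t > 0" "r \<in> {0<..<1}"
      unfolding e_def t_def r_def by (simp_all add: field_simps)
    moreover have "1 / (real n + 2) = 1 - r" by (simp add: r_def)
    ultimately show ?thesis
      using pA unfolding property_A_def P_def e_def[symmetric] t_def[symmetric]
      by (metis greaterThanLessThan_iff)
  qed
  then obtain t' r' A where P: "\<And>n. P n (t' n) (r' n) (A n)"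
    by metis
  have t': "0 < t' n" and r': "0 < r' n \<and> r' n < 1" for n
    using P[of n] by (simp_all add: P_def)
  have A: "A n x \<noteq> {} \<and> finite (A n x) \<and> A n x \<subseteq> fuzzy_ball X M x (r' n) (t' n) \<times> UNIV"
    if "x \<in> X" for n x
    using P[of n] that by (simp add: P_def)
  have AA: "real (card (sym_diff (A n x) (A n y))) < (1 / 2) ^ n * real (card (A n x \<inter> A n y))"
    if "x \<in> X" "y \<in> X" "1 / (real n + 2) < M x y (real n + 1)" for n x y
    using P[of n] that by (simp add: P_def)
  define q where "q n x y = unit_indicator_sqdist (A n x) (A n y)" for n x y
  have A_X: "A n x \<subseteq> X \<times> UNIV" if "x \<in> X" for n x
    using A[OF that, of n] by (auto simp: fuzzy_ball_def)
  have q_nonneg: "0 \<le> q n x y" if "x \<in> X" "y \<in> X" for n x y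
    unfolding q_def using A that by (intro unit_indicator_sqdist_nonneg) auto
  have q_has_sum: "((\<lambda>k. (unit_indicator (A n x) k - unit_indicator (A n y) k)\<^sup>2) has_sum q n x y)
      (X \<times> UNIV)" if "x \<in> X" "y \<in> X" for n x y
    unfolding q_def using A A_X that by (intro has_sum_unit_indicator_diff) auto
  \<comment> \<open>The majorant depends on \<open>a\<close> and \<open>t\<close> only. It serves
    twice: for convergence at a single pair and for the uniform bound on distances.\<close>
  have q_bound: "\<exists>h. summable h \<and> (\<forall>x\<in>X. \<forall>y\<in>X. a \<le> M x y t \<longrightarrow> (\<forall>n. q n x y \<le> h n))"
    if a: "0 < a" and t: "0 < t" for a t
  proof -
    \<comment> \<open>From level \<open>N\<close> on, every pair with \<open>a \<le> M x y t\<close>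
      meets the closeness condition of that level; earlier levels get the trivial bound 2.\<close>
    obtain N where N: "1 / a < real N" "t < real N"
      by (metis reals_Archimedean2 max_less_iff_conj)
    define h where "h n = (if n \<in> {..<N} then 2 else 0) + 2 * (1 / 2 :: real) ^ n" for n
    have "summable h"
      unfolding h_def
      by (intro summable_add summable_If_finite_set summable_mult summable_geometric) auto
    moreover have "q n x y \<le> h n" if xy: "x \<in> X" "y \<in> X" and M: "a \<le> M x y t" for n x y
    proof (cases "n < N")
      case True
      then show ?thesis
        using unit_indicator_sqdist_le_2[of "A n x" "A n y"] by (simp add: h_def q_def add_increasing2)
    next
      case False
      then have n: "1 / a < real n + 2" "t \<le> real n + 1" using N by linarith+
      then have "1 / (real n + 2) < a" using a by (simp add: field_simps)
      also have "a \<le> M x y (real n + 1)"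
        using M fm_mono[OF xy t n(2)] by simp
      finally have "q n x y \<le> 2 * (1 / 2) ^ n"
        unfolding q_def using A xy by (intro unit_indicator_sqdist_le AA) auto
      then show ?thesis using False by (simp add: h_def)
    qed
    ultimately show ?thesis by blast
  qed
  have q_summable: "summable (\<lambda>n. q n x y)" if xy: "x \<in> X" "y \<in> X" for x y
  proof -
    obtain h where h: "summable h" "\<And>n. q n x y \<le> h n"
      using q_bound[OF fm_pos[OF xy zero_less_one] zero_less_one] xy by blast
    show ?thesis
      using h q_nonneg[OF xy] by (intro summable_comparison_test'[OF h(1), of 0]) auto
  qed
  have "\<exists>f :: 'a \<Rightarrow> ell2. \<forall>x\<in>X. \<forall>y\<in>X. (\<lambda>n. q n x y) sums (dist (f x) (f y))\<^sup>2"
    by (rule direct_sum_to_ell2[where I = "X \<times> UNIV" and u = "\<lambda>n x. unit_indicator (A n x)"])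
      (use ctb in simp, rule q_has_sum, assumption+, rule q_summable, assumption+)
  then obtain f :: "'a \<Rightarrow> ell2" where
    f: "\<And>x y. x \<in> X \<Longrightarrow> y \<in> X \<Longrightarrow> (\<lambda>n. q n x y) sums (dist (f x) (f y))\<^sup>2"
    by blast
  have expansive: "uniformly_expansive X M (standard_fuzzy_metric dist) f"
    unfolding uniformly_expansive_def
  proof (intro allI impI)
    fix a t :: real assume a: "0 < a" and t: "0 < t"
    obtain h where h: "summable h" "\<forall>x\<in>X. \<forall>y\<in>X. a \<le> M x y t \<longrightarrow> (\<forall>n. q n x y \<le> h n)"
      using q_bound[OF a t] by blast
    \<comment> \<open>If no pair qualifies, nothing known of \<open>h\<close> fixes the sign of its
      sum; hence the absolute value.\<close>
    define R where "R = sqrt \<bar>suminf h\<bar>"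
    have R: "0 \<le> R" by (simp add: R_def)
    have "dist (f x) (f y) \<le> R" if xy: "x \<in> X" "y \<in> X" and M: "a \<le> M x y t" for x y
    proof -
      have "(dist (f x) (f y))\<^sup>2 \<le> suminf h"
        using h(2) xy M by (intro sums_le[OF _ f[OF xy] summable_sums[OF h(1)]]) blast
      then show ?thesis
        unfolding R_def by (intro real_le_rsqrt) simp
    qed
    \<comment> \<open>The bound \<open>1 / (1 + R)\<close> would equal 1 for \<open>R = 0\<close>;
      the 2 keeps it below 1.\<close>
    then have "\<forall>x\<in>X. \<forall>y\<in>X. a \<le> M x y t \<longrightarrow> 1 / (2 + R) \<le> standard_fuzzy_metric dist (f x) (f y) 1"
      unfolding standard_fuzzy_metric_def using R by (auto intro!: divide_left_mono add_mono mult_pos_pos add_pos_nonneg)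
    moreover have "1 / (2 + R) \<in> {0<..<1}" using R by simp
    ultimately show "\<exists>B\<in>{0<..<1}. \<exists>t'>0. \<forall>x\<in>X. \<forall>x'\<in>X. a \<le> M x x' t \<longrightarrow>
        B \<le> standard_fuzzy_metric dist (f x) (f x') t'"
      using zero_less_one by blast
  qed
  have proper: "effectively_proper X M (standard_fuzzy_metric dist) f"
    unfolding effectively_proper_def
  proof (intro allI impI)
    fix c t :: real assume c: "0 < c" and t: "0 < t"
    \<comment> \<open>A value of at least \<open>c\<close> bounds the distance by
      \<open>t / c\<close>, while disjoint sets at all levels below \<open>K\<close> would make its
      square at least \<open>2 * K\<close>.\<close>
    obtain K :: nat where K: "(t / c)\<^sup>2 < real K" using reals_Archimedean2 by blast
    define D where "D n = tnorm (1 - r' n) (1 - r' n)" for n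
    \<comment> \<open>The level where the sets meet depends on the pair, so \<open>T\<close> and
      \<open>D0\<close> must serve all levels below \<open>K\<close>. The \<open>1 / 2\<close> in
      \<open>D0\<close> keeps it below 1.\<close>
    define T where "T = 1 + (\<Sum>n<K. 2 * t' n)"
    define D0 where "D0 = Min (insert (1 / 2) (D ` {..<K}))"
    have "0 < D n" for n
    proof -
      have r: "1 - r' n \<in> {0..1}" "1 - r' n \<noteq> 0" using r'[of n] by auto
      then have "D n \<noteq> 0" using nzd unfolding tnorm_no_zero_divisors_def D_def by blast
      then show ?thesis using tnorm_closed[OF r(1) r(1)] by (simp add: D_def)
    qed
    then have "0 < D0" by (simp add: D0_def)
    moreover have "D0 \<le> 1 / 2" unfolding D0_def by (intro Min_le) auto
    ultimately have D0: "D0 \<in> {0<..<1}" by simp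
    have D0_le: "D0 \<le> D n" if "n < K" for n
      unfolding D0_def using that by (intro Min_le) auto
    have T_ge: "t' n + t' n \<le> T" if "n < K" for n
      using member_le_sum[of n "{..<K}" "\<lambda>n. 2 * t' n"] that t' by (simp add: T_def less_imp_le)
    have T: "0 < T" unfolding T_def using t' by (intro add_pos_nonneg sum_nonneg) (auto simp: less_imp_le)
    have "D0 \<le> M x y T" if xy: "x \<in> X" "y \<in> X" and le: "c \<le> standard_fuzzy_metric dist (f x) (f y) t" for x y
    proof -
      have "0 < t + dist (f x) (f y)" using t by (simp add: add_pos_nonneg)
      then have "dist (f x) (f y) \<le> t / c"
        using le c t by (simp add: standard_fuzzy_metric_def field_simps) (smt (verit) mult_pos_pos)
      then have "(dist (f x) (f y))\<^sup>2 < real K"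
        using K power_mono[of "dist (f x) (f y)" "t / c" 2] by simp
      moreover have "(\<Sum>n<K. q n x y) \<le> (dist (f x) (f y))\<^sup>2"
        using f[OF xy] q_nonneg[OF xy] by (metis finite_lessThan sum_le_suminf sums_iff)
      moreover have "(\<Sum>n<K. q n x y) = 2 * real K" if "\<And>n. n < K \<Longrightarrow> A n x \<inter> A n y = {}"
        using that by (simp add: q_def unit_indicator_sqdist_disjoint)
      ultimately obtain n where n: "n < K" "A n x \<inter> A n y \<noteq> {}" by fastforce
      \<comment> \<open>\<open>z\<close> is the first coordinate of a common element of the two
        sets.\<close>
      then obtain z where z: "z \<in> X" "1 - r' n \<le> M x z (t' n)" "1 - r' n \<le> M y z (t' n)"
        using A[OF xy(1), of n] A[OF xy(2), of n] by (fastforce simp: fuzzy_ball_def)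
      have "D0 \<le> D n" using D0_le n by blast
      also have "\<dots> \<le> M x y (t' n + t' n)"
        unfolding D_def using xy z t'[of n] r'[of n] by (intro fm_common_neighbour) auto
      also have "\<dots> \<le> M x y T"
        using xy t'[of n] T_ge[OF n(1)] by (intro fm_mono) auto
      finally show ?thesis .
    qed
    then show "\<exists>D\<in>{0<..<1}. \<exists>t'>0. \<forall>x\<in>X. \<forall>x'\<in>X. c \<le> standard_fuzzy_metric dist (f x) (f x') t \<longrightarrow>
        D \<le> M x x' t'"
      using D0 T by blast
  qed
  show ?thesis using expansive proper by (auto simp: coarse_embedding_def)
qed

end

theorem theorem6p4:
  fixes X :: "'a set"
    and M :: "'a \<Rightarrow> 'a \<Rightarrow> real \<Rightarrow> real"
    and tnorm :: "real \<Rightarrow> real \<Rightarrow> real"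
  assumes "fuzzy_metric_space X M tnorm"
    and "tnorm_no_zero_divisors tnorm"
    and "uniformly_locally_finite X M"
    and "property_A X M"
  shows "\<exists>f :: 'a \<Rightarrow> ell2. coarse_embedding X M UNIV (standard_fuzzy_metric dist) f"
proof -
  interpret fuzzy_metric_space X M tnorm by fact
  show ?thesis
    using assms countable_if_uniformly_locally_finite by (intro coarse_embedding_ell2)
qed

end
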